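(* Let $\mathcal{G}=(\mathcal{N},\mathcal{X}=\prod_{i=1}^N\mathbb{R}^{n_i},\{u_i\}_{i=1}^N)$ be a $\lambda$-cocoercive continuous game ($\lambda>0$) whose set of Nash equilibria $\mathcal{X}^*$ is nonempty. Let $(\mathbf{x}_t)_{t\ge0}$ be the noisy online gradient descent iterates $\mathbf{x}_{t+1}=\mathbf{x}_t+\eta_{t+1}(\mathbf{v}(\mathbf{x}_t)+\xi_{t+1})$ with absolute random noise, i.e. $\mathbb{E}[\xi_{t+1}\mid\mathcal{F}_t]=0$ and $\mathbb{E}[\|\xi_{t+1}\|^2\mid\mathcal{F}_t]\le\sigma_t^2$ for all $t\ge0$. Suppose there is a function $a:\mathbb{R}^+\to\mathbb{R}^+$ with $a(t)=o(1)$ and $a(t)=\Omega(1/t)$ such that $$\frac{1}{T+1}\left(\sum_{t=0}^{T-1}(t+1)\sigma_t^2\right)=O(a(T)).$$ Suppose the step-size sequence is nonincreasing and satisfies $0<\underline{\eta}\le\eta_t\le\overline{\eta}<\lambda$ for all $t\ge1$. Then $\mathbb{E}[\epsilon(\mathbf{x}_T)]=O(a(T))$ as $T\to\infty$.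
   Context: A continuous game $\mathcal{G}=(\mathcal{N},\mathcal{X}=\prod_{i=1}^N\mathcal{X}_i,\{u_i\}_{i=1}^N)$ consists of a finite set of players $\mathcal{N}=\{1,\dots,N\}$, action sets $\mathcal{X}_i$ (here $\mathcal{X}_i=\mathbb{R}^{n_i}$), and payoff functions $u_i:\mathcal{X}\to\mathbb{R}$ such that each $u_i$ is continuous in $\mathbf{x}$, continuously differentiable in $x_i$, and the partial gradient $\nabla_{x_i}u_i(\mathbf{x})$ is Lipschitz continuous in $\mathbf{x}$. Write $v_i(\mathbf{x})=\nabla_{x_i}u_i(\mathbf{x})$ and $\mathbf{v}(\mathbf{x})=(v_1(\mathbf{x}),\dots,v_N(\mathbf{x}))$. A point $\mathbf{x}^*\in\mathcal{X}$ is a Nash equilibrium if for every $i$, $u_i(x_i^*,\mathbf{x}_{-i}^* )\ge u_i(x_i,\mathbf{x}_{-i}^* )$ for all $x_i\in\mathcal{X}_i$, where $\mathbf{x}_{-i}$ denotes the joint action of all players except $i$. The game is $\lambda$-cocoercive if $(\mathbf{x}'-\mathbf{x})^\top(\mathbf{v}(\mathbf{x}')-\mathbf{v}(\mathbf{x}))\le-\lambda\|\mathbf{v}(\mathbf{x}')-\mathbf{v}(\mathbf{x})\|^2$ for all $\mathbf{x},\mathbf{x}'\in\mathcal{X}$. The norm $\|\cdot\|$ is Euclidean, and $\epsilon(\mathbf{x})=\|\mathbf{v}(\mathbf{x})\|^2$. The initial point $\mathbf{x}_0$ is arbitrary (deterministic). The noise $(\xi_t)_{t\ge1}$ is an $L^2$-bounded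 martingale difference sequence adapted to the history $(\mathcal{F}_t)$ of the iterates ($\mathbf{x}_t$ and $\xi_t$ are $\mathcal{F}_t$-measurable). The step-sizes $\eta_t$ and the $\sigma_t$ are deterministic. *)

theory Defs
  imports "HOL-Probability.Probability" "HOL-Library.Landau_Symbols"
begin

section \<open>Continuous games on products of Euclidean spaces\<close>

text \<open>
  The dimensions \<open>n\<^sub>i\<close> of the action sets may differ from player to player, so the joint
  action space, the product of the spaces \<open>\<real>\<^bsup>n\<^sub>i\<^esup>\<close>, is represented in flattened form: \<open>'d\<close> is the
  finite set of all scalar coordinates, \<open>own c\<close> is the player to whom coordinate \<open>c\<close> belongs, and a
  joint action is a vector of type \<open>real ^ 'd\<close>. Thus \<open>n\<^sub>i = card {c. own c = i}\<close>, the block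
  \<open>x\<^sub>i\<close> of \<open>x\<close> consists of the coordinates owned by \<open>i\<close>, and the Euclidean norm and inner
  product of \<open>real ^ 'd\<close> are those of the product.
\<close>

text \<open>\<open>deviate own i y x\<close> is \<open>(y\<^sub>i, x\<^sub>-\<^sub>i)\<close>; only the block of \<open>y\<close> owned by \<open>i\<close> is used.\<close>

definition deviate :: "('d::finite \<Rightarrow> 'p) \<Rightarrow> 'p \<Rightarrow> real ^ 'd \<Rightarrow> real ^ 'd \<Rightarrow> real ^ 'd" where
  "deviate own i y x = (\<chi> c. if own c = i then y $ c else x $ c)"

text \<open>
  The gradient at \<open>x\<^sub>i\<close> of \<open>y\<^sub>i \<mapsto> u\<^sub>i (y\<^sub>i, x\<^sub>-\<^sub>i)\<close>. The function of \<open>y\<close> below does not depend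
  on the coordinates outside the block of \<open>i\<close>, so \<open>D\<close> is that gradient, extended by zero
  outside the block.
\<close>

definition has_partial_gradient ::
    "('d::finite \<Rightarrow> 'p) \<Rightarrow> ('p \<Rightarrow> real ^ 'd \<Rightarrow> real) \<Rightarrow> 'p \<Rightarrow> real ^ 'd \<Rightarrow> real ^ 'd \<Rightarrow> bool" where
  "has_partial_gradient own u i x D \<longleftrightarrow> GDERIV (\<lambda>y. u i (deviate own i y x)) x :> D"

definition partial_gradient ::
    "('d::finite \<Rightarrow> 'p) \<Rightarrow> ('p \<Rightarrow> real ^ 'd \<Rightarrow> real) \<Rightarrow> 'p \<Rightarrow> real ^ 'd \<Rightarrow> real ^ 'd" where
  "partial_gradient own u i x = (THE D. has_partial_gradient own u i x D)"

text \<open>The concatenation of the blocks \<open>v\<^sub>i(x)\<close>.\<close>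

definition game_gradient ::
    "('d::finite \<Rightarrow> 'p) \<Rightarrow> ('p \<Rightarrow> real ^ 'd \<Rightarrow> real) \<Rightarrow> real ^ 'd \<Rightarrow> real ^ 'd" where
  "game_gradient own u x = (\<chi> c. partial_gradient own u (own c) x $ c)"

definition continuous_game ::
    "('d::finite \<Rightarrow> 'p::finite) \<Rightarrow> ('p \<Rightarrow> real ^ 'd \<Rightarrow> real) \<Rightarrow> bool" where
  "continuous_game own u \<longleftrightarrow>
     (\<forall>i. continuous_on UNIV (u i) \<and>
          (\<forall>x. \<exists>D. has_partial_gradient own u i x D) \<and>
          (\<forall>x. continuous_on UNIV (\<lambda>y. partial_gradient own u i (deviate own i y x))) \<and>
          (\<exists>L. L-lipschitz_on UNIV (partial_gradient own u i)))"

definition nash_equilibria ::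
    "('d::finite \<Rightarrow> 'p) \<Rightarrow> ('p \<Rightarrow> real ^ 'd \<Rightarrow> real) \<Rightarrow> (real ^ 'd) set" where
  "nash_equilibria own u = {x. \<forall>i y. u i x \<ge> u i (deviate own i y x)}"

definition cocoercive_game ::
    "('d::finite \<Rightarrow> 'p) \<Rightarrow> ('p \<Rightarrow> real ^ 'd \<Rightarrow> real) \<Rightarrow> real \<Rightarrow> bool" where
  "cocoercive_game own u l \<longleftrightarrow>
     (\<forall>x x'. (x' - x) \<bullet> (game_gradient own u x' - game_gradient own u x)
              \<le> - l * (norm (game_gradient own u x' - game_gradient own u x))\<^sup>2)"

definition equilibrium_gap ::
    "('d::finite \<Rightarrow> 'p) \<Rightarrow> ('p \<Rightarrow> real ^ 'd \<Rightarrow> real) \<Rightarrow> real ^ 'd \<Rightarrow> real" where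
  "equilibrium_gap own u x = (norm (game_gradient own u x))\<^sup>2"


section \<open>Stochastic setting\<close>

definition cond_exp_vec ::
    "'w measure \<Rightarrow> 'w measure \<Rightarrow> ('w \<Rightarrow> real ^ 'd) \<Rightarrow> 'w \<Rightarrow> real ^ 'd::finite" where
  "cond_exp_vec M F X w = (\<chi> c. real_cond_exp M F (\<lambda>w. X w $ c) w)"

definition sub_filtration :: "'w measure \<Rightarrow> (nat \<Rightarrow> 'w measure) \<Rightarrow> bool" where
  "sub_filtration M F \<longleftrightarrow> filtration (space M) F \<and> (\<forall>t. subalgebra M (F t))"

text \<open>The noise is indexed from 1; \<open>\<xi> 0\<close> plays no role.\<close>

definition L2_bounded_mds ::
    "'w measure \<Rightarrow> (nat \<Rightarrow> 'w measure) \<Rightarrow> (nat \<Rightarrow> 'w \<Rightarrow> real ^ 'd::finite) \<Rightarrow> bool" where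
  "L2_bounded_mds M F \<xi> \<longleftrightarrow>
     (\<forall>t\<ge>1. \<xi> t \<in> borel_measurable (F t)) \<and>
     (\<forall>t\<ge>1. integrable M (\<lambda>w. (norm (\<xi> t w))\<^sup>2)) \<and>
     (\<exists>B. \<forall>t\<ge>1. (\<integral>w. (norm (\<xi> t w))\<^sup>2 \<partial>M) \<le> B) \<and>
     (\<forall>t. AE w in M. cond_exp_vec M (F t) (\<xi> (Suc t)) w = 0)"

definition cond_variance_bound ::
    "'w measure \<Rightarrow> (nat \<Rightarrow> 'w measure) \<Rightarrow> (nat \<Rightarrow> 'w \<Rightarrow> real ^ 'd::finite) \<Rightarrow> (nat \<Rightarrow> real) \<Rightarrow> bool"
  where
  "cond_variance_bound M F \<xi> \<sigma> \<longleftrightarrow>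
     (\<forall>t. AE w in M. real_cond_exp M (F t) (\<lambda>w. (norm (\<xi> (Suc t) w))\<^sup>2) w \<le> (\<sigma> t)\<^sup>2)"

definition noisy_ogd ::
    "('d::finite \<Rightarrow> 'p) \<Rightarrow> ('p \<Rightarrow> real ^ 'd \<Rightarrow> real) \<Rightarrow> 'w measure \<Rightarrow> (nat \<Rightarrow> real) \<Rightarrow>
     (nat \<Rightarrow> 'w \<Rightarrow> real ^ 'd) \<Rightarrow> real ^ 'd \<Rightarrow> (nat \<Rightarrow> 'w \<Rightarrow> real ^ 'd) \<Rightarrow> bool" where
  "noisy_ogd own u M \<eta> \<xi> x0 x \<longleftrightarrow>
     (\<forall>w\<in>space M. x 0 w = x0 \<and>
        (\<forall>t. x (Suc t) w = x t w + \<eta> (Suc t) *\<^sub>R (game_gradient own u (x t w) + \<xi> (Suc t) w)))"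

end

(*
  Fix a zero z of v.  Cocoercivity with eta < l gives, in expectation,
  E|x' - z|^2 <= E|x - z|^2 - eta l E|v(x)|^2 + eta^2 sigma^2, and, pathwise,
  |v(x')|^2 <= |v(x)|^2 + |xi|^2.  Hence (t + 1) E|v(x_t)|^2 plus a multiple of E|x_t - z|^2
  grows by at most a constant times (t + 1) sigma_t^2 in each step.
*)
theory Submission
  imports Defs
begin

text \<open>First-order optimality: at an equilibrium each player's payoff, as a function of its own
  deviation, has a global maximum at \<open>z\<close>, so its derivative vanishes there.\<close>

lemma game_gradient_nash_eq_0:
  assumes game: "continuous_game own u" and z: "z \<in> nash_equilibria own u"
  shows "game_gradient own u z = 0"
proof -
  have self: "deviate own i z z = z" for i
    by (simp add: deviate_def vec_eq_iff)
  \<comment> \<open>Proved for every candidate \<open>D\<close>: together with the existence of a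
    gradient in a continuous game this settles both halves of the description by
    \<open>THE\<close>.\<close>
  have D0: "D = 0" if "has_partial_gradient own u i z D" for i D
  proof -
    have "((\<lambda>y. u i (deviate own i y z)) has_derivative (\<lambda>h. h \<bullet> D)) (at z)"
      using that by (simp add: has_partial_gradient_def gderiv_def)
    moreover have "\<forall>\<^sub>F y in at z. u i (deviate own i y z) \<le> u i (deviate own i z z)"
      using z by (simp add: nash_equilibria_def self)
    ultimately have "(\<lambda>h. h \<bullet> D) = (\<lambda>h. 0)"
      by (rule has_derivative_local_max)
    from fun_cong[OF this, of D] have "D \<bullet> D = 0" .
    then show ?thesis by simp
  qed
  have "partial_gradient own u i z = 0" for i
    unfolding partial_gradient_def
  proof (rule the_equality)
    obtain D where "has_partial_gradient own u i z D"
      using game unfolding continuous_game_def by blast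
    with D0 show "has_partial_gradient own u i z 0" by metis
  qed (rule D0)
  then show ?thesis by (simp add: game_gradient_def vec_eq_iff)
qed

section \<open>Deterministic consequences of cocoercivity\<close>

lemma cocoercive_lipschitz:
  fixes v :: "'a::real_inner \<Rightarrow> 'a"
  assumes coco: "\<And>x y. (y - x) \<bullet> (v y - v x) \<le> - l * (norm (v y - v x))\<^sup>2" and l: "l > 0"
  shows "(1 / l)-lipschitz_on UNIV v"
proof (rule lipschitz_onI)
  fix x y :: 'a
  have "l * (norm (v x - v y))\<^sup>2 \<le> - ((x - y) \<bullet> (v x - v y))"
    using coco[of x y] by simp
  also have "\<dots> \<le> norm (x - y) * norm (v x - v y)"
    using Cauchy_Schwarz_ineq2[of "x - y" "v x - v y"] by linarith
  finally have "l * norm (v x - v y) * norm (v x - v y) \<le> norm (x - y) * norm (v x - v y)"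
    by (simp add: power2_eq_square mult.assoc)
  then have "l * norm (v x - v y) \<le> norm (x - y)"
    by (cases "norm (v x - v y) = 0") (auto simp: mult_le_cancel_right)
  then show "dist (v x) (v y) \<le> 1 / l * dist x y"
    using l by (simp add: dist_norm field_simps)
qed (use l in simp)

text \<open>Comparing \<open>x\<close> with the zero \<open>z\<close>, cocoercivity makes the cross
  term of the expanded square at most \<open>- 2 * h * l\<close> times the squared gradient norm.
  Since \<open>h \<le> l\<close>, the quadratic term gives back at most half of this.\<close>

lemma cocoercive_step_dist_le:
  fixes v :: "'a::real_inner \<Rightarrow> 'a"
  assumes coco: "\<And>x y. (y - x) \<bullet> (v y - v x) \<le> - l * (norm (v y - v x))\<^sup>2"
    and z: "v z = 0" and h: "0 \<le> h" "h \<le> l"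
  shows "(norm (x - z + h *\<^sub>R v x))\<^sup>2 \<le> (norm (x - z))\<^sup>2 - h * l * (norm (v x))\<^sup>2"
proof -
  have "(norm (x - z + h *\<^sub>R v x))\<^sup>2
      = (norm (x - z))\<^sup>2 + 2 * h * ((x - z) \<bullet> v x) + h * h * (norm (v x))\<^sup>2"
    by (simp add: power2_norm_eq_inner inner_add_left inner_add_right inner_commute)
  moreover have "h * ((x - z) \<bullet> v x) \<le> h * (- l * (norm (v x))\<^sup>2)"
    using coco[of x z] z h by (intro mult_left_mono) (auto simp: inner_diff_left)
  moreover have "h * h * (norm (v x))\<^sup>2 \<le> h * l * (norm (v x))\<^sup>2"
    using h by (intro mult_right_mono mult_left_mono) auto
  ultimately show ?thesis by (simp add: algebra_simps)
qed

text \<open>The displacement is \<open>h\<close> times \<open>v x + n\<close>, so cocoercivity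
  bounds the inner product of \<open>v x + n\<close> with the change \<open>d\<close> of the
  gradient by minus the squared norm of \<open>d\<close>. What remains after expanding the new gap
  is at most the squared norm of \<open>n\<close> minus that of \<open>d + n\<close>. The bound is
  pathwise, so the correlation of \<open>d\<close> with the noise does no harm.\<close>

lemma cocoercive_step_gap_le:
  fixes v :: "'a::real_inner \<Rightarrow> 'a"
  assumes coco: "\<And>x y. (y - x) \<bullet> (v y - v x) \<le> - l * (norm (v y - v x))\<^sup>2"
    and h: "0 < h" "h \<le> l"
  shows "(norm (v (x + h *\<^sub>R (v x + n))))\<^sup>2 \<le> (norm (v x))\<^sup>2 + (norm n)\<^sup>2"
proof -
  define y where "y = x + h *\<^sub>R (v x + n)"
  define d where "d = v y - v x"
  have "h * ((v x + n) \<bullet> d) \<le> - l * (norm d)\<^sup>2"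
    using coco[of y x] by (simp add: y_def d_def)
  also have "\<dots> \<le> h * (- (norm d)\<^sup>2)"
    using h by (simp add: mult_right_mono)
  finally have "(v x + n) \<bullet> d \<le> - (norm d)\<^sup>2"
    using h(1) by (rule mult_left_le_imp_le)
  moreover have "(norm (v y))\<^sup>2 = (norm (v x))\<^sup>2 + 2 * (v x \<bullet> d) + (norm d)\<^sup>2"
    by (simp add: d_def power2_norm_eq_inner inner_diff_left inner_diff_right inner_commute)
  moreover have "0 \<le> (norm (d + n))\<^sup>2" by simp
  then have "0 \<le> (norm d)\<^sup>2 + 2 * (n \<bullet> d) + (norm n)\<^sup>2"
    by (simp add: power2_norm_eq_inner inner_add_left inner_add_right inner_commute)
  ultimately show ?thesis by (simp add: y_def inner_add_left)
qed

section \<open>Square-integrable random vectors and orthogonality to the noise\<close>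

lemma integrable_inner_square:
  fixes f g :: "'w \<Rightarrow> 'a::euclidean_space"
  assumes [measurable]: "f \<in> borel_measurable M" "g \<in> borel_measurable M"
    and f: "integrable M (\<lambda>w. (norm (f w))\<^sup>2)" and g: "integrable M (\<lambda>w. (norm (g w))\<^sup>2)"
  shows "integrable M (\<lambda>w. f w \<bullet> g w)"
proof (rule Bochner_Integration.integrable_bound[OF Bochner_Integration.integrable_add[OF f g]])
  have "\<bar>f w \<bullet> g w\<bar> \<le> (norm (f w))\<^sup>2 + (norm (g w))\<^sup>2" for w
  proof -
    have "\<bar>f w \<bullet> g w\<bar> \<le> norm (f w) * norm (g w)" by (rule Cauchy_Schwarz_ineq2)
    moreover have "2 * (norm (f w) * norm (g w)) \<le> (norm (f w))\<^sup>2 + (norm (g w))\<^sup>2"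
      using sum_squares_bound[of "norm (f w)" "norm (g w)"] by simp
    moreover have "0 \<le> norm (f w) * norm (g w)" by simp
    ultimately show ?thesis by linarith
  qed
  then show "AE w in M. norm (f w \<bullet> g w) \<le> norm ((norm (f w))\<^sup>2 + (norm (g w))\<^sup>2)"
    by simp
qed measurable

lemma borel_measurable_vec_nth_compose:
  fixes f :: "'w \<Rightarrow> real ^ 'd::finite"
  assumes "f \<in> borel_measurable M"
  shows "(\<lambda>w. f w $ c) \<in> borel_measurable M"
  using measurable_compose[OF assms borel_measurable_nth] .

text \<open>In each coordinate the \<open>F\<close>-measurable factor can be pulled out, which
  replaces \<open>g\<close> by its conditional expectation, zero almost everywhere. Summing over the
  coordinates gives the inner product.\<close>

lemma (in sigma_finite_subalgebra) integral_inner_cond_exp_zero: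
  fixes f g :: "'a \<Rightarrow> real ^ 'd::finite"
  assumes f: "f \<in> borel_measurable F" and g: "g \<in> borel_measurable M"
    and f2: "integrable M (\<lambda>w. (norm (f w))\<^sup>2)" and g2: "integrable M (\<lambda>w. (norm (g w))\<^sup>2)"
    and ce: "AE w in M. cond_exp_vec M F g w = 0"
  shows "(\<integral>w. f w \<bullet> g w \<partial>M) = 0"
proof -
  note f' = measurable_from_subalg[OF subalg f]
  have sq: "integrable M (\<lambda>w. (norm (k w $ c))\<^sup>2)"
    if k: "k \<in> borel_measurable M" and k2: "integrable M (\<lambda>w. (norm (k w))\<^sup>2)"
    for k :: "'a \<Rightarrow> real ^ 'd" and c
  proof (rule Bochner_Integration.integrable_bound[OF k2])
    note [measurable] = borel_measurable_vec_nth_compose[OF k]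
    show "(\<lambda>w. (norm (k w $ c))\<^sup>2) \<in> borel_measurable M" by measurable
    have "(k w $ c)\<^sup>2 \<le> (norm (k w))\<^sup>2" for w
      using component_le_norm_cart[of "k w" c] by (simp add: abs_le_square_iff[symmetric])
    then show "AE w in M. norm ((norm (k w $ c))\<^sup>2) \<le> norm ((norm (k w))\<^sup>2)" by simp
  qed
  have int: "integrable M (\<lambda>w. f w $ c * g w $ c)" for c
    \<comment> \<open>The inner product of the reals is multiplication, so the vector lemma applies
      to single coordinates.\<close>
    using integrable_inner_square[OF borel_measurable_vec_nth_compose[OF f']
        borel_measurable_vec_nth_compose[OF g] sq[OF f' f2] sq[OF g g2], of c c]
    by simp
  have "(\<integral>w. f w $ c * g w $ c \<partial>M) = 0" for c
  proof -
    have "(\<integral>w. f w $ c * g w $ c \<partial>M) = (\<integral>w. f w $ c * real_cond_exp M F (\<lambda>w. g w $ c) w \<partial>M)"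
      by (rule real_cond_exp_intg(2)[symmetric, OF int borel_measurable_vec_nth_compose[OF f]
            borel_measurable_vec_nth_compose[OF g]])
    also have "\<dots> = 0"
    proof (rule integral_eq_zero_AE)
      show "AE w in M. f w $ c * real_cond_exp M F (\<lambda>w. g w $ c) w = 0"
        using ce by eventually_elim (simp add: cond_exp_vec_def vec_eq_iff)
    qed
    finally show ?thesis .
  qed
  then show ?thesis
    by (simp add: inner_vec_def int)
qed

text \<open>The left-hand side is a potential. Raising the weight of the gap from
  \<open>T + 1\<close> to \<open>T + 2\<close> costs \<open>c * e T\<close>, exactly the decrease
  that \<open>dist\<close> supplies; only multiples of \<open>s T\<close> are left.\<close>

lemma weighted_descent_bound:
  fixes d e s :: "nat \<Rightarrow> real"
  assumes dist: "\<And>t. d (Suc t) + c * e t \<le> d t + b * s t"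
    and gap: "\<And>t. e (Suc t) \<le> e t + s t"
    and nonneg: "0 \<le> c" "0 \<le> b" "\<And>t. 0 \<le> s t"
  shows "c * (real T + 1) * e T + d T \<le> c * e 0 + d 0 + (b + 2 * c) * (\<Sum>t<T. (real t + 1) * s t)"
proof (induction T)
  case (Suc T)
  have "c * (real T + 2) * e (Suc T) \<le> c * (real T + 2) * (e T + s T)"
    using nonneg gap by (intro mult_left_mono) auto
  \<comment> \<open>The slack between the allowed growth \<open>(b + 2 * c) * (T + 1) * s T\<close>
    and the actual growth \<open>(c * (T + 2) + b) * s T\<close>.\<close>
  moreover have "0 \<le> (b + c) * real T * s T"
    using nonneg by simp
  ultimately show ?case
    using Suc dist[of T] by (simp add: algebra_simps)
qed simp

theorem theoremA4:
  fixes own :: "'d::finite \<Rightarrow> 'p::finite"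
    and u :: "'p \<Rightarrow> real ^ 'd \<Rightarrow> real"
    and l \<eta>lo \<eta>hi :: real
    and M :: "'w measure"
    and F :: "nat \<Rightarrow> 'w measure"
    and \<xi> x :: "nat \<Rightarrow> 'w \<Rightarrow> real ^ 'd"
    and x0 :: "real ^ 'd"
    and \<eta> \<sigma> :: "nat \<Rightarrow> real"
    and a :: "real \<Rightarrow> real"
  assumes game: "continuous_game own u"
    and l_pos: "l > 0"
    and cocoercive: "cocoercive_game own u l"
    and nash: "nash_equilibria own u \<noteq> {}"
    and prob: "prob_space M"
    and filt: "sub_filtration M F"
    and ogd: "noisy_ogd own u M \<eta> \<xi> x0 x"
    and adapted: "\<And>t. x t \<in> borel_measurable (F t)"
    and mds: "L2_bounded_mds M F \<xi>"
    and variance: "cond_variance_bound M F \<xi> \<sigma>"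
    and a_pos: "\<And>t. t > 0 \<Longrightarrow> a t > 0"
    and a_small: "a \<in> o[at_top](\<lambda>_. 1)"
    and a_large: "a \<in> \<Omega>[at_top](\<lambda>t. 1 / t)"
    and noise_sum:
      "(\<lambda>T::nat. 1 / (real T + 1) * (\<Sum>t<T. (real t + 1) * (\<sigma> t)\<^sup>2)) \<in> O[at_top](\<lambda>T. a (real T))"
    and steps_noninc: "\<And>t. t \<ge> 1 \<Longrightarrow> \<eta> (Suc t) \<le> \<eta> t"
    and steps_lower: "0 < \<eta>lo" "\<And>t. t \<ge> 1 \<Longrightarrow> \<eta>lo \<le> \<eta> t"
    and steps_upper: "\<And>t. t \<ge> 1 \<Longrightarrow> \<eta> t \<le> \<eta>hi" "\<eta>hi < l"
  shows "(\<forall>T. integrable M (\<lambda>w. equilibrium_gap own u (x T w))) \<and>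
         (\<lambda>T::nat. \<integral>w. equilibrium_gap own u (x T w) \<partial>M) \<in> O[at_top](\<lambda>T. a (real T))"
proof -
  interpret prob_space M by (rule prob)
  define v where "v = game_gradient own u"
  obtain z where z: "v z = 0"
    using nash game_gradient_nash_eq_0[OF game] unfolding v_def by blast
  have coco: "(y - x) \<bullet> (v y - v x) \<le> - l * (norm (v y - v x))\<^sup>2" for x y
    using cocoercive by (simp add: cocoercive_game_def v_def)
  \<comment> \<open>Used for the measurability of \<open>v\<close> and, since
    \<open>v z = 0\<close>, to bound the gap by the squared distance to \<open>z\<close>.\<close>
  have lip: "(1 / l)-lipschitz_on UNIV v"
    by (rule cocoercive_lipschitz[OF coco l_pos])
  have v_meas [measurable]: "v \<in> borel_measurable borel"
    by (rule borel_measurable_continuous_onI[OF lipschitz_on_continuous_on[OF lip]])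
  have norm_v: "norm (v y) \<le> norm (y - z) / l" for y
    using lipschitz_onD[OF lip, of y z] z by (simp add: dist_norm)
  have sub: "subalgebra M (F t)" for t
    using filt by (simp add: sub_filtration_def)
  have sfs: "sigma_finite_subalgebra M (F t)" for t
    by (intro finite_measure_subalgebra_is_sigma_finite finite_measure_subalgebra.intro
        finite_measure_subalgebra_axioms.intro sub finite_measure_axioms)
  have eta: "\<eta>lo \<le> \<eta> (Suc t)" "\<eta> (Suc t) \<le> l" "0 < \<eta> (Suc t)" for t
    using steps_lower(1) steps_lower(2)[of "Suc t"] steps_upper(1)[of "Suc t"] steps_upper(2)
    by simp_all
  have step: "x (Suc t) w = x t w + \<eta> (Suc t) *\<^sub>R (v (x t w) + \<xi> (Suc t) w)"
    if "w \<in> space M" for t w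
    using ogd that by (simp add: noisy_ogd_def v_def)
  have x0: "x 0 w = x0" if "w \<in> space M" for w
    using ogd that by (simp add: noisy_ogd_def)
  have [measurable]: "x t \<in> borel_measurable M" for t
    by (rule measurable_from_subalg[OF sub adapted])
  have xi_meas [measurable]: "\<xi> (Suc t) \<in> borel_measurable M" for t
    using mds by (intro measurable_from_subalg[OF sub]) (auto simp: L2_bounded_mds_def)
  have xi2: "integrable M (\<lambda>w. (norm (\<xi> (Suc t) w))\<^sup>2)" for t
    using mds by (simp add: L2_bounded_mds_def)
  have ce: "AE w in M. cond_exp_vec M (F t) (\<xi> (Suc t)) w = 0" for t
    using mds by (simp add: L2_bounded_mds_def)
  have xi_var: "(\<integral>w. (norm (\<xi> (Suc t) w))\<^sup>2 \<partial>M) \<le> (\<sigma> t)\<^sup>2" for t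
  proof -
    interpret sigma_finite_subalgebra M "F t" by (rule sfs)
    have "(\<integral>w. (norm (\<xi> (Suc t) w))\<^sup>2 \<partial>M)
        = (\<integral>w. real_cond_exp M (F t) (\<lambda>w. (norm (\<xi> (Suc t) w))\<^sup>2) w \<partial>M)"
      by (rule real_cond_exp_int(2)[OF xi2, symmetric])
    also have "\<dots> \<le> (\<integral>w. (\<sigma> t)\<^sup>2 \<partial>M)"
      using variance real_cond_exp_int(1)[OF xi2]
      by (intro integral_mono_AE) (auto simp: cond_variance_bound_def)
    finally show ?thesis by (simp add: prob_space)
  qed

  \<comment> \<open>Square integrability of the iterates\<close>
  define y where "y t w = x t w - z + \<eta> (Suc t) *\<^sub>R v (x t w)" for t w
  \<comment> \<open>The noise-free update leaves out \<open>\<xi> (Suc t)\<close>, so it is known at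
    time \<open>t\<close> and hence orthogonal to that noise.\<close>
  have y_F: "y t \<in> borel_measurable (F t)" for t
    unfolding y_def using adapted[of t] by measurable
  have [measurable]: "y t \<in> borel_measurable M" for t
    by (rule measurable_from_subalg[OF sub y_F])
  have y_le: "(norm (y t w))\<^sup>2 \<le> (norm (x t w - z))\<^sup>2 - \<eta> (Suc t) * l * (norm (v (x t w)))\<^sup>2" for t w
    unfolding y_def using eta[of t] by (intro cocoercive_step_dist_le[OF coco z]) auto
  have expand: "(norm (x (Suc t) w - z))\<^sup>2 = (norm (y t w))\<^sup>2
      + 2 * \<eta> (Suc t) * (y t w \<bullet> \<xi> (Suc t) w) + (\<eta> (Suc t))\<^sup>2 * (norm (\<xi> (Suc t) w))\<^sup>2"
    if "w \<in> space M" for t w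
  proof -
    have "x (Suc t) w - z = y t w + \<eta> (Suc t) *\<^sub>R \<xi> (Suc t) w"
      using step[OF that] by (simp add: y_def algebra_simps)
    then show ?thesis
      by (simp add: power2_norm_eq_inner inner_add_left inner_add_right inner_commute
          power2_eq_square[of "\<eta> _"] algebra_simps)
  qed
  have y2: "integrable M (\<lambda>w. (norm (y t w))\<^sup>2)"
    if "integrable M (\<lambda>w. (norm (x t w - z))\<^sup>2)" for t
  proof (rule Bochner_Integration.integrable_bound[OF that])
    have "(norm (y t w))\<^sup>2 \<le> (norm (x t w - z))\<^sup>2" for w
    proof -
      have "0 \<le> \<eta> (Suc t) * l * (norm (v (x t w)))\<^sup>2"
        using eta(3)[of t] l_pos by simp
      with y_le[of t w] show ?thesis by linarith
    qed
    then show "AE w in M. norm ((norm (y t w))\<^sup>2) \<le> norm ((norm (x t w - z))\<^sup>2)" by simp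
  qed measurable
  \<comment> \<open>The deterministic start is trivially integrable; the noise-free update does not
    increase the distance to \<open>z\<close>, and the added noise is square integrable.\<close>
  have d_int: "integrable M (\<lambda>w. (norm (x t w - z))\<^sup>2)" for t
  proof (induction t)
    case 0
    show ?case
      by (subst Bochner_Integration.integrable_cong[OF refl,
            where g = "\<lambda>_. (norm (x0 - z))\<^sup>2"]) (simp_all add: x0)
  next
    case (Suc t)
    have "integrable M (\<lambda>w. y t w \<bullet> \<xi> (Suc t) w)"
      by (rule integrable_inner_square[OF _ _ y2[OF Suc] xi2]) measurable
    then have "integrable M (\<lambda>w. (norm (y t w))\<^sup>2
      + 2 * \<eta> (Suc t) * (y t w \<bullet> \<xi> (Suc t) w) + (\<eta> (Suc t))\<^sup>2 * (norm (\<xi> (Suc t) w))\<^sup>2)"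
      using y2[OF Suc] xi2[of t] by simp
    then show ?case
      by (subst Bochner_Integration.integrable_cong[OF refl expand])
  qed
  have e_int: "integrable M (\<lambda>w. (norm (v (x t w)))\<^sup>2)" for t
  proof (rule Bochner_Integration.integrable_bound)
    show "integrable M (\<lambda>w. (norm (x t w - z))\<^sup>2 / l\<^sup>2)" using d_int by simp
    have "(norm (v (x t w)))\<^sup>2 \<le> (norm (x t w - z))\<^sup>2 / l\<^sup>2" for w
      using power_mono[OF norm_v norm_ge_zero, of "x t w" 2] by (simp add: power_divide)
    then show "AE w in M. norm ((norm (v (x t w)))\<^sup>2) \<le> norm ((norm (x t w - z))\<^sup>2 / l\<^sup>2)" by simp
  qed measurable

  \<comment> \<open>Recursions for the expected distance and the expected gap\<close>
  define d where "d t = (\<integral>w. (norm (x t w - z))\<^sup>2 \<partial>M)" for t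
  define e where "e t = (\<integral>w. (norm (v (x t w)))\<^sup>2 \<partial>M)" for t
  have nonneg: "0 \<le> d t" "0 \<le> e t" for t
    by (simp_all add: d_def e_def)
  \<comment> \<open>Coefficients independent of \<open>t\<close> come from bounding the step-size
    below by \<open>\<eta>lo\<close> in the descent term and above by \<open>l\<close> in the noise
    term.\<close>
  have dist_rec: "d (Suc t) + \<eta>lo * l * e t \<le> d t + l\<^sup>2 * (\<sigma> t)\<^sup>2" for t
  proof -
    interpret sigma_finite_subalgebra M "F t" by (rule sfs)
    have cross: "integrable M (\<lambda>w. y t w \<bullet> \<xi> (Suc t) w)"
      by (rule integrable_inner_square[OF _ _ y2[OF d_int] xi2]) measurable
    have "d (Suc t) = (\<integral>w. (norm (y t w))\<^sup>2 + 2 * \<eta> (Suc t) * (y t w \<bullet> \<xi> (Suc t) w)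
        + (\<eta> (Suc t))\<^sup>2 * (norm (\<xi> (Suc t) w))\<^sup>2 \<partial>M)"
      unfolding d_def by (rule Bochner_Integration.integral_cong[OF refl expand])
    also have "\<dots> = (\<integral>w. (norm (y t w))\<^sup>2 \<partial>M)
        + 2 * \<eta> (Suc t) * (\<integral>w. y t w \<bullet> \<xi> (Suc t) w \<partial>M)
        + (\<eta> (Suc t))\<^sup>2 * (\<integral>w. (norm (\<xi> (Suc t) w))\<^sup>2 \<partial>M)"
      using y2[OF d_int] cross xi2 by simp
    also have "(\<integral>w. y t w \<bullet> \<xi> (Suc t) w \<partial>M) = 0"
      by (rule integral_inner_cond_exp_zero[OF y_F xi_meas y2[OF d_int] xi2 ce])
    finally have "d (Suc t) = (\<integral>w. (norm (y t w))\<^sup>2 \<partial>M)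
        + (\<eta> (Suc t))\<^sup>2 * (\<integral>w. (norm (\<xi> (Suc t) w))\<^sup>2 \<partial>M)" by simp
    moreover have "(\<integral>w. (norm (y t w))\<^sup>2 \<partial>M)
        \<le> (\<integral>w. (norm (x t w - z))\<^sup>2 - \<eta> (Suc t) * l * (norm (v (x t w)))\<^sup>2 \<partial>M)"
      using y2[OF d_int] d_int e_int y_le by (intro integral_mono) auto
    moreover have "\<dots> = d t - \<eta> (Suc t) * l * e t"
      using d_int e_int by (simp add: d_def e_def)
    moreover have "(\<eta> (Suc t))\<^sup>2 * (\<integral>w. (norm (\<xi> (Suc t) w))\<^sup>2 \<partial>M) \<le> l\<^sup>2 * (\<sigma> t)\<^sup>2"
      using eta[of t] xi_var by (intro mult_mono power_mono) auto
    moreover have "\<eta>lo * l * e t \<le> \<eta> (Suc t) * l * e t"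
      using eta(1)[of t] l_pos nonneg by (intro mult_right_mono) auto
    ultimately show ?thesis by linarith
  qed
  have gap_rec: "e (Suc t) \<le> e t + (\<sigma> t)\<^sup>2" for t
  proof -
    have "e (Suc t) \<le> (\<integral>w. (norm (v (x t w)))\<^sup>2 + (norm (\<xi> (Suc t) w))\<^sup>2 \<partial>M)"
      unfolding e_def
    proof (rule integral_mono)
      show "(norm (v (x (Suc t) w)))\<^sup>2 \<le> (norm (v (x t w)))\<^sup>2 + (norm (\<xi> (Suc t) w))\<^sup>2"
        if "w \<in> space M" for w
        unfolding step[OF that] using eta[of t] by (intro cocoercive_step_gap_le[OF coco]) auto
    qed (use e_int xi2 in simp_all)
    also have "\<dots> = e t + (\<integral>w. (norm (\<xi> (Suc t) w))\<^sup>2 \<partial>M)"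
      using e_int xi2 by (simp add: e_def)
    finally show ?thesis using xi_var[of t] by linarith
  qed

  \<comment> \<open>Asymptotic rate\<close>
  define c where "c = \<eta>lo * l"
  define S where "S T = 1 / (real T + 1) * (\<Sum>t<T. (real t + 1) * (\<sigma> t)\<^sup>2)" for T
  have c: "c > 0" using steps_lower(1) l_pos by (simp add: c_def)
  have e_le: "e T \<le> (c * e 0 + d 0) / c * (1 / (real T + 1)) + (l\<^sup>2 + 2 * c) / c * S T" for T
  proof -
    have "c * (real T + 1) * e T + d T
        \<le> c * e 0 + d 0 + (l\<^sup>2 + 2 * c) * (\<Sum>t<T. (real t + 1) * (\<sigma> t)\<^sup>2)"
      using c dist_rec gap_rec by (intro weighted_descent_bound) (auto simp: c_def)
    then have "e T * (c * (real T + 1))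
        \<le> c * e 0 + d 0 + (l\<^sup>2 + 2 * c) * (\<Sum>t<T. (real t + 1) * (\<sigma> t)\<^sup>2)"
      \<comment> \<open>The distance part \<open>d T\<close> of the potential is nonnegative and is
        dropped.\<close>
      using nonneg(1)[of T] by (simp add: mult.commute)
    then have "e T \<le> (c * e 0 + d 0 + (l\<^sup>2 + 2 * c) * (\<Sum>t<T. (real t + 1) * (\<sigma> t)\<^sup>2))
        / (c * (real T + 1))"
      using c by (subst pos_le_divide_eq) auto
    also have "\<dots> = (c * e 0 + d 0) / c * (1 / (real T + 1)) + (l\<^sup>2 + 2 * c) / c * S T"
      by (simp add: S_def add_divide_distrib[of "c * e 0 + d 0"])
    finally show ?thesis .
  qed
  \<comment> \<open>Here the lower bound on \<open>a\<close> enters: it absorbs the contribution of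
    the initial point.\<close>
  have inv_le_a: "(\<lambda>T. 1 / (real T + 1)) \<in> O(\<lambda>T. a (real T))"
  proof (rule landau_o.big_trans)
    show "(\<lambda>T. 1 / (real T + 1)) \<in> O(\<lambda>T. 1 / real T)"
      by (rule landau_o.big_mono) (auto intro!: eventually_mono[OF eventually_gt_at_top[of 0]]
          simp: field_simps)
    have "(\<lambda>t. 1 / t) \<in> O[at_top](a)"
      using a_large by (simp add: bigomega_iff_bigo)
    then show "(\<lambda>T. 1 / real T) \<in> O(\<lambda>T. a (real T))"
      by (rule landau_o.big.compose[OF _ filterlim_real_sequentially])
  qed
  have scaled: "(\<lambda>T. k * f T) \<in> O(\<lambda>T. a (real T))"
    if "f \<in> O(\<lambda>T. a (real T))" for k :: real and f :: "nat \<Rightarrow> real"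
    \<comment> \<open>The case \<open>k = 0\<close> does occur: the factor
      \<open>(c * e 0 + d 0) / c\<close> vanishes if the iteration starts at
      \<open>z\<close>.\<close>
    using that by (cases "k = 0") auto
  have "e \<in> O(\<lambda>T. a (real T))"
  proof (rule landau_o.big_trans)
    show "e \<in> O(\<lambda>T. (c * e 0 + d 0) / c * (1 / (real T + 1)) + (l\<^sup>2 + 2 * c) / c * S T)"
    proof (intro landau_o.big_mono always_eventually allI)
      fix T
      show "norm (e T) \<le> norm ((c * e 0 + d 0) / c * (1 / (real T + 1)) + (l\<^sup>2 + 2 * c) / c * S T)"
        \<comment> \<open>Nonnegativity of \<open>e\<close> turns the one-sided bound into one on
          absolute values.\<close>
        using order_trans[OF e_le[of T] abs_ge_self] nonneg(2)[of T] by (simp only: real_norm_def abs_of_nonneg)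
    qed
    have "S \<in> O(\<lambda>T. a (real T))"
      using noise_sum unfolding S_def .
    then show "(\<lambda>T. (c * e 0 + d 0) / c * (1 / (real T + 1)) + (l\<^sup>2 + 2 * c) / c * S T)
        \<in> O(\<lambda>T. a (real T))"
      using inv_le_a by (intro sum_in_bigo scaled)
  qed
  then show ?thesis
    using e_int by (simp add: equilibrium_gap_def v_def e_def[abs_def])
qed

end
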